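(* Let $n=p_1^{k_1}\cdots p_t^{k_t}$ for some nonnegative integers $k_1,\dots,k_t$ and pairwise distinct primes $p_1,\dots,p_t$. Then for any $m=p_1^{s_1}\cdots p_t^{s_t}$ (with $s_1,\dots,s_t$ nonnegative integers) satisfying $m\le\lfloor n/2\rfloor$, the binomial coefficient $\binom nm$ is a nonnegative integer combination of $\binom n1,\binom n{p_1^{s_1}},\binom n{p_2^{s_2}},\dots,\binom n{p_t^{s_t}}$.
   Context: A nonnegative integer combination of integers $a_0,\dots,a_t$ is a sum $\sum_i \lambda_i a_i$ with all $\lambda_i$ nonnegative integers. *)

theory Defs
  imports Main "HOL-Computational_Algebra.Primes"
begin

definition nonneg_int_combination :: "nat \<Rightarrow> (nat \<Rightarrow> int) \<Rightarrow> int \<Rightarrow> bool" where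
  "nonneg_int_combination t a x \<longleftrightarrow> (\<exists>l :: nat \<Rightarrow> nat. x = (\<Sum>i = 0..t. int (l i) * a i))"

end

theory Submission
  imports Defs "HOL-Number_Theory.Cong" "HOL-Algebra.Exponent"
begin

text \<open>
  Write \<open>q\<^sub>i = p\<^sub>i ^ s\<^sub>i\<close>. Since \<open>n\<close> divides \<open>q\<^sub>i * (n choose q\<^sub>i)\<close>, the number \<open>n choose q\<^sub>i\<close> is
  divisible by \<open>p\<^sub>j ^ k\<^sub>j\<close> for all \<open>j \<noteq> i\<close>, so the congruences modulo the prime powers of \<open>n\<close>
  decouple: there are coefficients \<open>l\<^sub>i < q\<^sub>i\<close>, chosen independently, such that \<open>n choose m\<close> and
  \<open>\<Sum>i. l\<^sub>i * (n choose q\<^sub>i)\<close> agree modulo \<open>n = n choose 1\<close>. If at least two of the \<open>q\<^sub>i\<close> exceed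
  \<open>1\<close>, then \<open>n choose m\<close> is so much larger than each \<open>n choose q\<^sub>i\<close> that the difference is
  nonnegative; otherwise \<open>m\<close> is \<open>1\<close> or one of the \<open>q\<^sub>i\<close>.
\<close>

lemma dvd_mult_binomial:
  fixes n k :: nat
  assumes "0 < k"
  shows "n dvd k * (n choose k)"
  using times_binomial_minus1_eq[OF assms, of n] by simp

text \<open>Trinomial revision writes \<open>n choose (p ^ s * c)\<close> times
  \<open>p ^ s * c choose p ^ s\<close> as a multiple of \<open>n choose p ^ s\<close>, and the
  second factor is prime to \<open>p\<close>.\<close>

lemma binomial_prime_power_cong:
  fixes p s c n k :: nat
  assumes p: "prime p" and c: "\<not> p dvd c" and le: "p ^ s * c \<le> n" and k: "p ^ k dvd n"
  shows "\<exists>l < p ^ s. [l * (n choose p ^ s) = n choose (p ^ s * c)] (mod p ^ k)"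
proof -
  let ?q = "p ^ s" and ?a = "n choose p ^ s" and ?b = "n choose (p ^ s * c)"
  have c0: "1 \<le> c" using c by (cases c) auto
  have q0: "0 < ?q" using p by (simp add: prime_gt_0_nat)
  \<comment> \<open>As in Sylow's theorem, \<open>?q * c choose ?q\<close> has the same
    \<open>p\<close>-adic valuation as \<open>c\<close>.\<close>
  have "multiplicity p (?q * c choose ?q) = 0"
    using const_p_fac[OF _ p, of c s] c0 c by (simp add: not_dvd_imp_multiplicity_0)
  moreover have qc: "?q \<le> ?q * c" using mult_le_mono2[OF c0, of ?q] by (simp only: mult_1_right)
  then have "?q * c choose ?q \<noteq> 0" by (metis less_irrefl zero_less_binomial)
  ultimately have "\<not> p dvd (?q * c choose ?q)"
    using p by (metis multiplicity_eq_zero_iff not_prime_unit)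
  then have "coprime (p ^ k) (?q * c choose ?q)"
    using p by (simp add: prime_imp_coprime)
  then have cop: "coprime (gcd ?a (p ^ k)) (?q * c choose ?q)"
    by (meson coprime_divisors dvd_refl gcd_dvd2)
  have "?a dvd ?b * (?q * c choose ?q)"
    using choose_mult[OF qc le] by simp
  \<comment> \<open>\<open>?q * c choose ?q\<close> is a unit at \<open>p\<close>, so the \<open>p\<close>-part of \<open>?a\<close> divides \<open>?b\<close>.\<close>
  then have "gcd ?a (p ^ k) dvd ?b * (?q * c choose ?q)"
    by (meson dvd_trans gcd_dvd1)
  then have "gcd ?a (p ^ k) dvd ?b"
    using cop by (simp add: coprime_dvd_mult_left_iff)
  then obtain x where x: "[?a * x = ?b] (mod p ^ k)"
    using cong_solve_dvd_nat by blast
  \<comment> \<open>The coefficient only matters modulo \<open>?q\<close>.\<close>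
  have "p ^ k dvd ?q * ?a"
    using k dvd_mult_binomial[OF q0, of n] dvd_trans by blast
  then have "[x div ?q * (?q * ?a) + (x mod ?q) * ?a = 0 + (x mod ?q) * ?a] (mod p ^ k)"
    by (intro cong_add) (auto simp: cong_0_iff)
  moreover have "x div ?q * (?q * ?a) + (x mod ?q) * ?a = ?a * x"
    by (metis add_mult_distrib div_mult_mod_eq mult.assoc mult.commute)
  ultimately have "[(x mod ?q) * ?a = ?b] (mod p ^ k)"
    using x by (metis add_0 cong_sym cong_trans)
  then show ?thesis using q0 by (intro exI[of _ "x mod ?q"]) simp
qed

text \<open>The ratio of \<open>n choose m\<close> to \<open>n choose j\<close> is the product of
  \<open>(n - m + i) / (j + i)\<close> over \<open>1 \<le> i \<le> m - j\<close>. Each factor is at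
  least 3/2, since \<open>3 * j + i \<le> 2 * j + m \<le> 2 * m \<le> 2 * (n - m)\<close>.\<close>

lemma binomial_growth:
  fixes n m j :: nat
  assumes "2 * j \<le> m" "2 * m \<le> n"
  shows "3 ^ (m - j) * (n choose j) \<le> 2 ^ (m - j) * (n choose m)"
proof -
  have step: "3 ^ i * (fact (j + i) * fact (n - m)) \<le> (2 ^ i * (fact (n - m + i) * fact j) :: nat)"
    if "i \<le> m - j" for i
    using that
  proof (induction i)
    case (Suc i)
    have "3 * (j + Suc i) \<le> 2 * (n - m + Suc i)"
    proof -
      have "j + Suc i \<le> m" "m \<le> n - m" using Suc.prems assms by auto
      then show ?thesis using assms(1) unfolding add_mult_distrib2 by presburger
    qed
    then have "(3 * (j + Suc i)) * (3 ^ i * (fact (j + i) * fact (n - m)))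
        \<le> (2 * (n - m + Suc i)) * (2 ^ i * (fact (n - m + i) * fact j) :: nat)"
      using Suc by (intro mult_le_mono[OF _ Suc.IH]) auto
    then show ?case by (simp add: algebra_simps)
  qed simp
  have jm: "j + (m - j) = m" "n - m + (m - j) = n - j" using assms by auto
  have s: "3 ^ (m - j) * (fact m * fact (n - m)) \<le> (2 ^ (m - j) * (fact (n - j) * fact j) :: nat)"
    using step[of "m - j"] jm by simp
  have fj: "fact j * fact (n - j) * (n choose j) = (fact n :: nat)"
    and fm: "fact m * fact (n - m) * (n choose m) = (fact n :: nat)"
    using assms by (auto intro!: binomial_fact_lemma)
  let ?F = "fact j * fact (n - j) :: nat"
  have "?F * (3 ^ (m - j) * (n choose j)) = 3 ^ (m - j) * (fact m * fact (n - m)) * (n choose m)"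
    using fj fm by (simp add: mult_ac)
  also have "\<dots> \<le> 2 ^ (m - j) * (fact (n - j) * fact j) * (n choose m)"
    by (rule mult_le_mono1[OF s])
  also have "\<dots> = ?F * (2 ^ (m - j) * (n choose m))" by (simp add: mult_ac)
  finally show ?thesis by (simp only: mult_le_cancel1) simp
qed

lemma linear_times_two_power_le_three_power:
  assumes "3 \<le> d"
  shows "(2 * d - 3) * 2 ^ d \<le> (3 ^ d :: nat)"
  using assms
proof (induction d rule: dec_induct)
  case (step d)
  show ?case
  \<comment> \<open>Raising \<open>d\<close> by one multiplies \<open>2 * d - 3\<close> by at most
    3/2 only from \<open>d = 4\<close> on; the passage from 3 to 4 is the numerical fact 80 \<le>
    81.\<close>
  proof (cases "d = 3")
    case False
    then obtain e where "d = e + 4" using step.hyps by (intro that[of "d - 4"]) linarith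
    then have "(2 * Suc d - 3) * 2 \<le> 3 * (2 * d - 3)" by simp
    then have "(2 * Suc d - 3) * 2 * 2 ^ d \<le> 3 * (2 * d - 3) * 2 ^ d" by (rule mult_le_mono1)
    also have "\<dots> \<le> 3 * 3 ^ d" using step.IH by simp
    finally show ?thesis by simp
  qed simp
qed simp

text \<open>With \<open>d = m - j\<close>, the bound \<open>2 * j \<le> m\<close> gives
  \<open>m - 3 \<le> 2 * d - 3\<close>, and \<open>5 \<le> m\<close> then forces
  \<open>3 \<le> d\<close>, so the exponential growth yields a linear factor.\<close>

lemma binomial_mult_linear_le:
  fixes n m j :: nat
  assumes "2 * j \<le> m" "2 * m \<le> n" "5 \<le> m"
  shows "(m - 3) * (n choose j) \<le> n choose m"
proof -
  let ?d = "m - j"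
  have "2 ^ ?d * ((m - 3) * (n choose j)) \<le> (2 * ?d - 3) * 2 ^ ?d * (n choose j)"
    using assms by (simp add: mult_le_mono mult_ac)
  also have "\<dots> \<le> 3 ^ ?d * (n choose j)"
    using assms by (intro mult_le_mono1 linear_times_two_power_le_three_power) linarith
  also have "\<dots> \<le> 2 ^ ?d * (n choose m)" by (rule binomial_growth[OF assms(1,2)])
  finally show ?thesis by simp
qed

lemma sum_diff_one_le_prod_diff_one:
  fixes q :: "'a \<Rightarrow> nat"
  assumes "finite A" "\<And>i. i \<in> A \<Longrightarrow> 1 \<le> q i"
  shows "(\<Sum>i\<in>A. q i - 1) + 1 \<le> (\<Prod>i\<in>A. q i)"
  using assms
proof (induction A rule: finite_induct)
  case (insert x A)
  let ?P = "\<Prod>i\<in>A. q i"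
  have IH: "(\<Sum>i\<in>A. q i - 1) + 1 \<le> ?P" and x: "1 \<le> q x" using insert by auto
  obtain u v where uv: "q x = u + 1" "?P = v + 1"
    using IH x by (metis add.commute add_leD2 le_iff_add)
  then show ?case using insert.hyps IH by simp
qed simp

text \<open>Two distinct factors of size at least 2 improve the constant from 1 to 3. Equal factors
  2 and 2 would violate the bound. The left side later bounds the sum of the coefficients, hence the
  factor \<open>m - 3\<close> in the growth estimate.\<close>

lemma sum_diff_one_le_prod_diff_three:
  fixes q :: "'a \<Rightarrow> nat"
  assumes A: "finite A" "\<And>i. i \<in> A \<Longrightarrow> 1 \<le> q i"
    and ij: "i \<in> A" "j \<in> A" "2 \<le> q i" "2 \<le> q j" "q i \<noteq> q j"
  shows "(\<Sum>i\<in>A. q i - 1) + 3 \<le> (\<Prod>i\<in>A. q i)"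
proof -
  let ?B = "A - {i} - {j}"
  have B: "(\<Sum>i\<in>?B. q i - 1) + 1 \<le> prod q ?B"
    using A by (intro sum_diff_one_le_prod_diff_one) auto
  have ne: "j \<in> A - {i}" using ij by auto
  have S: "(\<Sum>i\<in>A. q i - 1) = (q i - 1) + ((q j - 1) + (\<Sum>i\<in>?B. q i - 1))"
    using sum.remove[OF A(1) ij(1), of "\<lambda>i. q i - 1"]
      sum.remove[OF _ ne, of "\<lambda>i. q i - 1"] A(1) by simp
  have P: "prod q A = q i * (q j * prod q ?B)"
    using prod.remove[OF A(1) ij(1), of q] prod.remove[OF _ ne, of q] A(1) by simp
  obtain a b c where abc: "q i = a + 2" "q j = b + 2" "prod q ?B = c + 1"
    using B ij by (metis add.commute add_leD2 le_iff_add)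
  have "1 \<le> a + b" using ij abc by auto
  then have "a + b + c + 5 \<le> (a + 2) * ((b + 2) * (c + 1))" by (simp add: algebra_simps)
  then show ?thesis unfolding S P using B abc by simp
qed

theorem theorem3p1:
  fixes t n m :: nat and p k s :: "nat \<Rightarrow> nat"
  assumes "\<And>i. i \<in> {1..t} \<Longrightarrow> prime (p i)"
    and "inj_on p {1..t}"
    and "n = (\<Prod>i = 1..t. p i ^ k i)"
    and "m = (\<Prod>i = 1..t. p i ^ s i)"
    and "m \<le> n div 2"
  shows "nonneg_int_combination t
           (\<lambda>i. int (if i = 0 then n choose 1 else n choose (p i ^ s i)))
           (int (n choose m))"
proof -
  let ?I = "{1..t}"
  define q where "q = (\<lambda>i. p i ^ s i)"
  note prime = assms(1) and inj = assms(2) and n = assms(3)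
  have m: "m = prod q ?I" using assms(4) by (simp add: q_def)
  have nm: "2 * m \<le> n" using assms(5) by simp
  have q1: "1 \<le> q i" if "i \<in> ?I" for i
    using prime[OF that] by (simp add: q_def prime_gt_0_nat Suc_leI)
  have pcop: "coprime (p i) (p j)" if "i \<in> ?I" "j \<in> ?I" "i \<noteq> j" for i j
    using primes_coprime[OF prime[OF that(1)] prime[OF that(2)]] inj_onD[OF inj _ that(1,2)] that(3)
    by blast
  have m_split: "m = q i * prod q (?I - {i})" if "i \<in> ?I" for i
    unfolding m using that by (intro prod.remove) auto
  have combI: ?thesis
    if eq: "n choose m = x * n + (\<Sum>i\<in>?I. l i * (n choose q i))" for x l
  proof -
    define l' where "l' = (\<lambda>i. if i = 0 then x else l i)"
    have "int (n choose m) = (\<Sum>i = 0..t. int (l' i) *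
        int (if i = 0 then n choose 1 else n choose (p i ^ s i)))"
      unfolding eq sum.atLeast_Suc_atMost[of 0 t, OF le0] by (simp add: l'_def q_def)
    then show ?thesis unfolding nonneg_int_combination_def by blast
  qed
  show ?thesis
  proof (cases "\<exists>i\<in>?I. \<exists>j\<in>?I. i \<noteq> j \<and> q i \<noteq> 1 \<and> q j \<noteq> 1")
    case False
    show ?thesis
    proof (cases "\<exists>i\<in>?I. q i \<noteq> 1")
      case True
      then obtain i where i: "i \<in> ?I" "q i \<noteq> 1" by blast
      have "q j = 1" if "j \<in> ?I - {i}" for j using False i that by blast
      then have "prod q (?I - {i}) = 1" by (intro prod.neutral) simp
      then have mi: "m = q i" using m_split[OF i(1)] by simp
      have "n choose m = 0 * n + (\<Sum>j\<in>?I. (if j = i then 1 else 0) * (n choose q j))"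
        using i(1) sum.remove[of ?I i "\<lambda>j. (if j = i then 1 else 0) * (n choose q j)"] by (simp add: mi)
      then show ?thesis by (rule combI)
    next
      case False
      then have "m = 1" unfolding m by (intro prod.neutral) auto
      then have "n choose m = 1 * n + (\<Sum>j\<in>?I. 0 * (n choose q j))" by simp
      then show ?thesis by (rule combI)
    qed
  next
    case True
    then obtain i\<^sub>0 j\<^sub>0 where ij: "i\<^sub>0 \<in> ?I" "j\<^sub>0 \<in> ?I" "i\<^sub>0 \<noteq> j\<^sub>0" "q i\<^sub>0 \<noteq> 1" "q j\<^sub>0 \<noteq> 1" by blast
    have "coprime (q i\<^sub>0) (q j\<^sub>0)" using pcop[OF ij(1-3)] by (simp add: q_def)
    then have ne: "q i\<^sub>0 \<noteq> q j\<^sub>0" using ij by auto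
    have q2: "2 \<le> q i\<^sub>0" "2 \<le> q j\<^sub>0" using q1[OF ij(1)] q1[OF ij(2)] ij(4,5) by linarith+
    have sum3: "(\<Sum>i\<in>?I. q i - 1) + 3 \<le> m"
      unfolding m by (rule sum_diff_one_le_prod_diff_three[OF _ q1 ij(1,2) q2 ne]) auto
    have "q i\<^sub>0 - 1 + (q j\<^sub>0 - 1) \<le> (\<Sum>i\<in>?I. q i - 1)"
      using sum_mono2[of ?I "{i\<^sub>0, j\<^sub>0}" "\<lambda>i. q i - 1"] ij by auto
    then have m5: "5 \<le> m" using sum3 q2 by linarith
    have "\<exists>l < q i. [l * (n choose q i) = n choose m] (mod p i ^ k i)" if i: "i \<in> ?I" for i
    proof -
      have "coprime (p i) (prod q (?I - {i}))"
        using pcop[OF i] by (intro prod_coprime_right) (auto simp: q_def)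
      then have "\<not> p i dvd prod q (?I - {i})"
        using prime[OF i] not_prime_unit coprime_absorb_left by blast
      moreover have "p i ^ k i dvd n" unfolding n using i by (intro dvd_prodI) auto
      moreover have "q i * prod q (?I - {i}) \<le> n" using m_split[OF i] nm by simp
      ultimately show ?thesis
        using binomial_prime_power_cong[OF prime[OF i], of "prod q (?I - {i})" "s i" n "k i"]
          m_split[OF i] by (simp add: q_def)
    qed
    then have "\<forall>i\<in>?I. \<exists>l. l < q i \<and> [l * (n choose q i) = n choose m] (mod p i ^ k i)"
      by blast
    from bchoice[OF this] obtain l where l: "\<And>i. i \<in> ?I \<Longrightarrow> l i < q i"
        "\<And>i. i \<in> ?I \<Longrightarrow> [l i * (n choose q i) = n choose m] (mod p i ^ k i)"
      by blast
    let ?S = "\<Sum>i\<in>?I. l i * (n choose q i)"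
    have "[?S = n choose m] (mod p i ^ k i)" if i: "i \<in> ?I" for i
    proof -
      \<comment> \<open>The other terms vanish modulo \<open>p i ^ k i\<close>, because
        \<open>q j\<close> is coprime to \<open>p i\<close>.\<close>
      have "p i ^ k i dvd l j * (n choose q j)" if j: "j \<in> ?I - {i}" for j
      proof -
        have "p i ^ k i dvd n" unfolding n using i by (intro dvd_prodI) auto
        then have "p i ^ k i dvd q j * (n choose q j)"
          using dvd_mult_binomial[of "q j" n] q1[of j] j by (auto intro: dvd_trans)
        moreover have "coprime (p i ^ k i) (q j)"
          using pcop[OF i, of j] j by (simp add: q_def)
        ultimately show ?thesis by (simp add: coprime_dvd_mult_right_iff)
      qed
      then have "p i ^ k i dvd (\<Sum>j\<in>?I - {i}. l j * (n choose q j))" by (rule dvd_sum)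
      then have "[l i * (n choose q i) + (\<Sum>j\<in>?I - {i}. l j * (n choose q j)) = (n choose m) + 0] (mod p i ^ k i)"
        using l(2)[OF i] by (intro cong_add) (auto simp: cong_0_iff)
      then show ?thesis using i by (subst sum.remove[of _ i]) auto
    qed
    then have cong: "[?S = n choose m] (mod n)"
      unfolding n using pcop by (intro coprime_cong_prod_nat) auto
    \<comment> \<open>Each \<open>n choose q i\<close> with \<open>l i \<noteq> 0\<close> is at most
      \<open>n choose m\<close> divided by \<open>m - 3\<close>, while the coefficients add up to at
      most \<open>m - 3\<close>.\<close>
    have "(m - 3) * ?S \<le> (m - 3) * (n choose m)"
    proof -
      have "(m - 3) * (l i * (n choose q i)) \<le> (q i - 1) * (n choose m)" if i: "i \<in> ?I" for i
      proof (cases "l i = 0")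
        case False
        then have "q i \<noteq> 1" using l(1)[OF i] by auto
        \<comment> \<open>One of \<open>i\<^sub>0\<close> and \<open>j\<^sub>0\<close> differs from
          \<open>i\<close>; its nontrivial factor gives \<open>2 * q i \<le> m\<close>, as the
          growth estimate requires.\<close>
        then obtain j where j: "j \<in> ?I - {i}" "q j \<noteq> 1"
          using ij that[of i\<^sub>0] that[of j\<^sub>0] by (cases "i = i\<^sub>0") simp_all
        have "q j dvd prod q (?I - {i})" using j by (intro dvd_prodI) auto
        moreover have "0 < prod q (?I - {i})" using q1 by (intro prod_pos) (auto simp: Suc_le_eq)
        ultimately have "2 \<le> prod q (?I - {i})"
          using dvd_imp_le[of "q j" "prod q (?I - {i})"] q1[of j] j by simp
        then have "2 * q i \<le> m" unfolding m_split[OF i] by simp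
        then have "(m - 3) * (n choose q i) \<le> n choose m"
          by (rule binomial_mult_linear_le[OF _ nm m5])
        moreover have "l i \<le> q i - 1" using l(1)[OF i] by simp
        ultimately have "l i * ((m - 3) * (n choose q i)) \<le> (q i - 1) * (n choose m)"
          by (rule mult_le_mono[rotated])
        then show ?thesis by (simp add: mult_ac)
      qed simp
      then have "(m - 3) * ?S \<le> (\<Sum>i\<in>?I. (q i - 1) * (n choose m))"
        unfolding sum_distrib_left by (rule sum_mono)
      also have "\<dots> = (\<Sum>i\<in>?I. q i - 1) * (n choose m)" by (simp add: sum_distrib_right)
      also have "\<dots> \<le> (m - 3) * (n choose m)" using sum3 by (intro mult_le_mono1) simp
      finally show ?thesis .
    qed
    then have le: "?S \<le> n choose m" using m5 by simp
    have "n dvd (n choose m) - ?S" using cong_altdef_nat[OF le] cong by (simp add: cong_sym_eq)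
    then obtain x where "(n choose m) - ?S = n * x" by (elim dvdE)
    then have "n choose m = x * n + ?S" using le by (simp add: mult.commute)
    then show ?thesis by (rule combI)
  qed
qed

end
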